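(* Let $\mathcal P=\langle X:\mathcal R\rangle$ be a group presentation with reduced Squier complex $\mathrm{Sq}^{\rho}(\mathcal P)$. For $q\in F(X)$ and $(l,r)\in\mathcal R$ set $\lambda_{l,r,q}=(q^{-1}l^{-1},l,r,q)\in S_1$. Then the following are a set of defining relations for the group $(\operatorname{star}_1(\mathrm{Sq}^{\rho}(\mathcal P)),* )$ on the generating set $S_1$: $$\lambda_{l,r,vsu}*\lambda_{s,d,u}=\lambda_{s,d,u}*\lambda_{l,r,vdu},$$ where $(l,r),(s,d)\in\mathcal R$ and $u,v\in F(X)$.
   Context: A group presentation $\mathcal P=\langle X:\mathcal R\rangle$ consists of a set $X$ and a set $\mathcal R\subseteq A^*\times A^*$ of pairs of words, where $A=X\cup X^{-1}$ and $A^*$ is the free monoid on $A$. $F(X)$ is the free group on $X$. The canonical map $\rho:A^*\to F(X)$ is suppressed: for $p,q\in F(X)$ and $(l,r)\in\mathcal R$, $plq$ and $prq$ denote $p(l\rho)q,\ p(r\rho)q\in F(X)$, and similarly for other products such as $vsu$ and $q^{-1}l^{-1}$. Reduced Squier complex $\mathrm{Sq}^{\rho}(\mathcal P)$: the 2-complex with vertex set $F(X)$; one edge $(p,l,r,q)$ for each $p,q\in F(X)$ and $(l,r)\in\mathcal R$, starting at $plq$ and ending at $prq$; and, for all $p,q,p',q'\in F(X)$ and $(l,r),(l',r')\in\mathcal R$, a 2-cell making the edge paths $(p,l,r,qp'l'q')\circ(prqp',l',r',q')$ and $(plqp',l',r',q')\circ(p,l,r,qp'r'q')$ homotopic. $\pi(\mathrm{Sq}^{\rho}(\mathcal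 P),F(X))$ is its fundamental groupoid: vertex set $F(X)$, morphisms the homotopy classes (relative to endpoints) of edge paths (which may traverse edges backwards), composed by concatenation $\circ$. The domain and range of a morphism $\alpha$ are written $\alpha\mathbf d$ and $\alpha\mathbf r$. $\operatorname{star}_1(\mathrm{Sq}^{\rho}(\mathcal P))$ is the set of morphisms with domain $1\in F(X)$. The group $F(X)$ acts on the left and right of this groupoid by the actions induced by $u\triangleright(p,l,r,q)=(up,l,r,q)$ and $(p,l,r,q)\triangleleft v=(p,l,r,qv)$ on edges. The operation $\alpha*\beta=(\alpha\triangleleft\beta\mathbf d)\circ(\alpha\mathbf r\triangleright\beta)$ makes $\operatorname{star}_1(\mathrm{Sq}^{\rho}(\mathcal P))$ a group. Edges are identified with the homotopy classes they represent. $S_1$ is the set of all edges starting at $1$: $S_1=\{(q^{-1}l^{-1},l,r,q): q\in F(X),\ (l,r)\in\mathcal R\}$; it generates the group $(\operatorname{star}_1(\mathrm{Sq}^{\rho}(\mathcal P)),* )$. *)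

theory Defs
  imports "HOL-Algebra.Generated_Groups"
begin

section \<open>Words and free groups\<close>

text \<open>The letter \<open>(x, True)\<close> stands for \<open>x\<close> and \<open>(x, False)\<close> for its formal inverse.
  Letters over edges are also used for the signed edges of an edge path.\<close>

type_synonym 'a letter = "'a \<times> bool"
type_synonym 'a word = "'a letter list"

definition flip :: "'a letter \<Rightarrow> 'a letter" where
  "flip a = (fst a, \<not> snd a)"

definition words :: "'a set \<Rightarrow> 'a word set" where
  "words X = lists (X \<times> UNIV)"

definition reduced :: "'a word \<Rightarrow> bool" where
  "reduced w \<longleftrightarrow> successively (\<lambda>a b. b \<noteq> flip a) w"

fun push :: "'a letter \<Rightarrow> 'a word \<Rightarrow> 'a word" where
  "push a [] = [a]"
| "push a (b # w) = (if b = flip a then w else a # b # w)"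

text \<open>Free reduction; this is the canonical map \<open>\<rho>\<close> from words to the free group, whose
  elements are represented by reduced words.\<close>

definition rho :: "'a word \<Rightarrow> 'a word" where
  "rho w = foldr push w []"

definition fmult :: "'a word \<Rightarrow> 'a word \<Rightarrow> 'a word" (infixl \<open>\<cdot>\<close> 70) where
  "u \<cdot> v = rho (u @ v)"

definition free_group :: "'a set \<Rightarrow> 'a word monoid" where
  "free_group X = \<lparr>carrier = {w \<in> words X. reduced w}, mult = fmult, one = []\<rparr>"

definition gen :: "'a \<Rightarrow> 'a word" where
  "gen x = [(x, True)]"

section \<open>Defining relations\<close>

text \<open>The homomorphism from the free group that extends a map \<open>\<gamma>\<close> of the generators into \<open>G\<close>.\<close>

definition free_lift :: "('g, 'm) monoid_scheme \<Rightarrow> ('s \<Rightarrow> 'g) \<Rightarrow> 's word \<Rightarrow> 'g" where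
  "free_lift G \<gamma> w =
     foldr (\<lambda>(s, b) g. (if b then \<gamma> s else inv\<^bsub>G\<^esub> (\<gamma> s)) \<otimes>\<^bsub>G\<^esub> g) w \<one>\<^bsub>G\<^esub>"

definition normal_closure :: "('g, 'm) monoid_scheme \<Rightarrow> 'g set \<Rightarrow> 'g set" where
  "normal_closure G A = \<Inter> {N. N \<lhd> G \<and> A \<subseteq> N}"

text \<open>The pairs in \<open>D\<close> are a set of defining relations for \<open>G\<close> on the generating set \<open>S\<close>, where
  \<open>\<gamma>\<close> sends a generator to the element of \<open>G\<close> that it denotes.\<close>

definition defining_relations ::
    "('g, 'm) monoid_scheme \<Rightarrow> 's set \<Rightarrow> ('s \<Rightarrow> 'g) \<Rightarrow> ('s word \<times> 's word) set \<Rightarrow> bool" where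
  "defining_relations G S \<gamma> D \<longleftrightarrow>
     group G \<and>
     \<gamma> ` S \<subseteq> carrier G \<and>
     generate G (\<gamma> ` S) = carrier G \<and>
     D \<subseteq> carrier (free_group S) \<times> carrier (free_group S) \<and>
     kernel (free_group S) G (free_lift G \<gamma>) =
       normal_closure (free_group S) {a \<otimes>\<^bsub>free_group S\<^esub> inv\<^bsub>free_group S\<^esub> b | a b. (a, b) \<in> D}"

section \<open>2-complexes and their fundamental groupoids\<close>

text \<open>An edge path is a start vertex together with a list of signed edges, so that every vertex has
  its own empty path. A 2-cell is given by a pair of edge paths that it makes homotopic.\<close>

type_synonym ('v, 'e) path = "'v \<times> 'e letter list"

record ('v, 'e) complex2 =
  verts :: "'v set"
  edges :: "'e set"
  source :: "'e \<Rightarrow> 'v"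
  target :: "'e \<Rightarrow> 'v"
  cells :: "(('v, 'e) path \<times> ('v, 'e) path) set"

definition lsource :: "('v, 'e) complex2 \<Rightarrow> 'e letter \<Rightarrow> 'v" where
  "lsource K a = (if snd a then source K (fst a) else target K (fst a))"

definition ltarget :: "('v, 'e) complex2 \<Rightarrow> 'e letter \<Rightarrow> 'v" where
  "ltarget K a = (if snd a then target K (fst a) else source K (fst a))"

fun walk :: "('v, 'e) complex2 \<Rightarrow> 'v \<Rightarrow> 'e letter list \<Rightarrow> bool" where
  "walk K v [] \<longleftrightarrow> True"
| "walk K v (a # es) \<longleftrightarrow> fst a \<in> edges K \<and> lsource K a = v \<and> walk K (ltarget K a) es"

definition paths :: "('v, 'e) complex2 \<Rightarrow> ('v, 'e) path set" where
  "paths K = {(v, es). v \<in> verts K \<and> walk K v es}"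

definition path_end :: "('v, 'e) complex2 \<Rightarrow> ('v, 'e) path \<Rightarrow> 'v" where
  "path_end K P = (if snd P = [] then fst P else ltarget K (last (snd P)))"

inductive homotopic :: "('v, 'e) complex2 \<Rightarrow> ('v, 'e) path \<Rightarrow> ('v, 'e) path \<Rightarrow> bool"
  for K :: "('v, 'e) complex2" where
  refl: "P \<in> paths K \<Longrightarrow> homotopic K P P"
| sym: "homotopic K P Q \<Longrightarrow> homotopic K Q P"
| trans: "homotopic K P Q \<Longrightarrow> homotopic K Q T \<Longrightarrow> homotopic K P T"
| cancel: "(v, es @ [a, flip a] @ fs) \<in> paths K \<Longrightarrow>
    homotopic K (v, es @ [a, flip a] @ fs) (v, es @ fs)"
| cell: "((w, cs), (w, ds)) \<in> cells K \<Longrightarrow> path_end K (v, es) = w \<Longrightarrow>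
    (v, es @ cs @ fs) \<in> paths K \<Longrightarrow> (v, es @ ds @ fs) \<in> paths K \<Longrightarrow>
    homotopic K (v, es @ cs @ fs) (v, es @ ds @ fs)"

definition hclass :: "('v, 'e) complex2 \<Rightarrow> ('v, 'e) path \<Rightarrow> ('v, 'e) path set" where
  "hclass K P = {Q. homotopic K P Q}"

definition hclasses :: "('v, 'e) complex2 \<Rightarrow> ('v, 'e) path set set" where
  "hclasses K = hclass K ` paths K"

definition mdom :: "('v, 'e) path set \<Rightarrow> 'v" where
  "mdom \<alpha> = the_elem (fst ` \<alpha>)"

definition mran :: "('v, 'e) complex2 \<Rightarrow> ('v, 'e) path set \<Rightarrow> 'v" where
  "mran K \<alpha> = the_elem (path_end K ` \<alpha>)"

text \<open>Composition is only meaningful when \<open>mran K \<alpha> = mdom \<beta>\<close>.\<close>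

definition mcomp ::
    "('v, 'e) complex2 \<Rightarrow> ('v, 'e) path set \<Rightarrow> ('v, 'e) path set \<Rightarrow> ('v, 'e) path set" where
  "mcomp K \<alpha> \<beta> = (\<Union>P\<in>\<alpha>. \<Union>Q\<in>\<beta>. hclass K (fst P, snd P @ snd Q))"

section \<open>The reduced Squier complex\<close>

definition group_presentation :: "'x set \<Rightarrow> ('x word \<times> 'x word) set \<Rightarrow> bool" where
  "group_presentation X R \<longleftrightarrow> R \<subseteq> words X \<times> words X"

text \<open>In an edge \<open>(p, l, r, q)\<close> the components \<open>p\<close>, \<open>q\<close> are elements of the free group, whereas
  \<open>l\<close>, \<open>r\<close> are words that need not be reduced.\<close>

type_synonym 'x edge = "'x word \<times> 'x word \<times> 'x word \<times> 'x word"

definition squier ::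
    "'x set \<Rightarrow> ('x word \<times> 'x word) set \<Rightarrow> ('x word, 'x edge) complex2" where
  "squier X R =
    \<lparr>verts = carrier (free_group X),
     edges = {(p, l, r, q). p \<in> carrier (free_group X) \<and> (l, r) \<in> R \<and> q \<in> carrier (free_group X)},
     source = (\<lambda>(p, l, r, q). p \<cdot> rho l \<cdot> q),
     target = (\<lambda>(p, l, r, q). p \<cdot> rho r \<cdot> q),
     cells =
       {((p \<cdot> rho l \<cdot> q \<cdot> p' \<cdot> rho l' \<cdot> q',
          [((p, l, r, q \<cdot> p' \<cdot> rho l' \<cdot> q'), True), ((p \<cdot> rho r \<cdot> q \<cdot> p', l', r', q'), True)]),
         (p \<cdot> rho l \<cdot> q \<cdot> p' \<cdot> rho l' \<cdot> q',
          [((p \<cdot> rho l \<cdot> q \<cdot> p', l', r', q'), True), ((p, l, r, q \<cdot> p' \<cdot> rho r' \<cdot> q'), True)]))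
        | p l r q p' l' r' q'.
          (l, r) \<in> R \<and> (l', r') \<in> R \<and>
          p \<in> carrier (free_group X) \<and> q \<in> carrier (free_group X) \<and>
          p' \<in> carrier (free_group X) \<and> q' \<in> carrier (free_group X)}\<rparr>"

text \<open>The two actions of the free group, on edge paths and on homotopy classes.\<close>

definition path_lact ::
    "'x word \<Rightarrow> ('x word, 'x edge) path \<Rightarrow> ('x word, 'x edge) path" where
  "path_lact u P = (u \<cdot> fst P, map (\<lambda>((p, l, r, q), b). ((u \<cdot> p, l, r, q), b)) (snd P))"

definition path_ract ::
    "('x word, 'x edge) path \<Rightarrow> 'x word \<Rightarrow> ('x word, 'x edge) path" where
  "path_ract P v = (fst P \<cdot> v, map (\<lambda>((p, l, r, q), b). ((p, l, r, q \<cdot> v), b)) (snd P))"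

definition lact ::
    "('x word, 'x edge) complex2 \<Rightarrow> 'x word \<Rightarrow> ('x word, 'x edge) path set
      \<Rightarrow> ('x word, 'x edge) path set" where
  "lact K u \<alpha> = (\<Union>P\<in>\<alpha>. hclass K (path_lact u P))"

definition ract ::
    "('x word, 'x edge) complex2 \<Rightarrow> ('x word, 'x edge) path set \<Rightarrow> 'x word
      \<Rightarrow> ('x word, 'x edge) path set" where
  "ract K \<alpha> v = (\<Union>P\<in>\<alpha>. hclass K (path_ract P v))"

definition star1 ::
    "'x set \<Rightarrow> ('x word \<times> 'x word) set \<Rightarrow> ('x word, 'x edge) path set monoid" where
  "star1 X R =
    \<lparr>carrier = {\<alpha> \<in> hclasses (squier X R). mdom \<alpha> = \<one>\<^bsub>free_group X\<^esub>},
     mult = (\<lambda>\<alpha> \<beta>. mcomp (squier X R)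
               (ract (squier X R) \<alpha> (mdom \<beta>)) (lact (squier X R) (mran (squier X R) \<alpha>) \<beta>)),
     one = hclass (squier X R) (\<one>\<^bsub>free_group X\<^esub>, [])\<rparr>"

definition S1 :: "'x set \<Rightarrow> ('x word \<times> 'x word) set \<Rightarrow> 'x edge set" where
  "S1 X R = {e \<in> edges (squier X R). source (squier X R) e = \<one>\<^bsub>free_group X\<^esub>}"

text \<open>Distinct edges may be homotopic. The generating symbols are the edges themselves, and
  \<open>edge_class\<close> sends an edge to the homotopy class with which it is identified.\<close>

definition edge_class ::
    "'x set \<Rightarrow> ('x word \<times> 'x word) set \<Rightarrow> 'x edge \<Rightarrow> ('x word, 'x edge) path set" where
  "edge_class X R e = hclass (squier X R) (source (squier X R) e, [(e, True)])"

definition lam :: "'x set \<Rightarrow> 'x word \<Rightarrow> 'x word \<Rightarrow> 'x word \<Rightarrow> 'x edge" where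
  "lam X l r q = (inv\<^bsub>free_group X\<^esub> q \<cdot> inv\<^bsub>free_group X\<^esub> (rho l), l, r, q)"

end

theory Submission
  imports Defs
begin

text \<open>Left translation by the free group makes a path from \<open>1\<close> the same thing as a word over \<open>S1\<close>:
  translate each signed edge so that the underlying edge starts at \<open>1\<close>; conversely, the letters of
  a word can be translated back, one after the other, to fit together into a path. Concatenation
  of words corresponds to \<open>*\<close>, cancelling an edge against its reverse corresponds to free
  reduction, and the two sides of a 2-cell have as words exactly the two sides of one of the
  proposed relations. Hence if a word represents \<open>1\<close>, then a homotopy contracting its path rewrites
  it to the empty word modulo the normal closure of the relators.\<close>

section \<open>Free groups as reduced words\<close>

text \<open>The formal inverse is total, unlike the inverse of \<open>free_group X\<close>, so
  cancellation laws hold for arbitrary words without carrier conditions; the two agree on the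
  carrier by \<open>inv_free_group\<close>.\<close>

definition winv :: "'a word \<Rightarrow> 'a word" where
  "winv w = rev (map flip w)"

lemma flip_flip [simp]: "flip (flip a) = a"
  by (simp add: flip_def)

lemma fst_flip [simp]: "fst (flip a) = fst a"
  by (simp add: flip_def)

lemma flip_mem_iff [simp]: "flip a \<in> X \<times> UNIV \<longleftrightarrow> a \<in> X \<times> UNIV"
  by (auto simp: flip_def mem_Times_iff)

lemma reduced_Nil [simp]: "reduced []"
  by (simp add: reduced_def)

lemma reduced_Cons: "reduced (a # w) \<longleftrightarrow> reduced w \<and> (w = [] \<or> hd w \<noteq> flip a)"
  by (auto simp: reduced_def successively_Cons)

lemma reduced_push: "reduced w \<Longrightarrow> reduced (push a w)"
  by (cases w) (auto simp: reduced_Cons)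

text \<open>Each letter thus acts as a permutation of the reduced words. If \<open>w\<close> is
  \<open>a # w'\<close>, then \<open>push (flip a)\<close> leaves \<open>w'\<close>, and reducedness
  prevents \<open>w'\<close> from starting with \<open>flip a\<close>, so that \<open>push a\<close>
  restores \<open>w\<close>.\<close>

lemma push_push_flip: "reduced w \<Longrightarrow> push a (push (flip a) w) = w"
proof (cases w)
  case (Cons b w')
  moreover assume "reduced w"
  ultimately show ?thesis
    by (cases w') (auto simp: reduced_Cons)
qed simp

lemma words_Nil [simp]: "[] \<in> words X"
  by (simp add: words_def)

lemma words_Cons [simp]: "a # w \<in> words X \<longleftrightarrow> a \<in> X \<times> UNIV \<and> w \<in> words X"
  by (simp add: words_def)

lemma words_append [simp]: "u @ v \<in> words X \<longleftrightarrow> u \<in> words X \<and> v \<in> words X"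
  by (auto simp: words_def)

lemma words_push: "a \<in> X \<times> UNIV \<Longrightarrow> w \<in> words X \<Longrightarrow> push a w \<in> words X"
  by (cases w) auto

lemma words_winv [simp]: "winv w \<in> words X \<longleftrightarrow> w \<in> words X"
  by (induction w) (auto simp: winv_def flip_def)

lemma rho_Nil [simp]: "rho [] = []"
  by (simp add: rho_def)

lemma rho_Cons: "rho (a # w) = push a (rho w)"
  by (simp add: rho_def)

lemma rho_append: "rho (u @ v) = foldr push u (rho v)"
  by (simp add: rho_def)

lemma reduced_rho [simp]: "reduced (rho w)"
  by (induction w) (auto simp: rho_Cons reduced_push)

lemma words_rho: "w \<in> words X \<Longrightarrow> rho w \<in> words X"
  by (induction w) (auto simp: rho_Cons words_push)

lemma rho_reduced: "reduced w \<Longrightarrow> rho w = w"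
proof (induction w)
  case (Cons a w)
  then show ?case
    by (cases w) (auto simp: rho_Cons reduced_Cons)
qed simp

lemma rho_rho [simp]: "rho (rho w) = rho w"
  by (simp add: rho_reduced)

lemma foldr_push_reduced: "reduced w \<Longrightarrow> reduced (foldr push u w)"
  by (induction u) (auto simp: reduced_push)

text \<open>Cancelling a pair in \<open>u\<close> does not change the permutation by which
  \<open>u\<close> acts on reduced words. This is van der Waerden's argument for associativity: it
  lets \<open>rho\<close> be dropped inside the left factor of a product.\<close>

lemma foldr_push_push:
  assumes "reduced w"
  shows "foldr push (push a u) w = push a (foldr push u w)"
  by (cases u) (auto simp: push_push_flip foldr_push_reduced assms)

lemma rho_append_rho_right [simp]: "rho (u @ rho v) = rho (u @ v)"
  by (simp add: rho_append)

lemma rho_append_rho_left [simp]: "rho (rho u @ v) = rho (u @ v)"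
  by (induction u) (simp_all add: rho_append rho_Cons foldr_push_push)

lemma fmult_assoc: "u \<cdot> v \<cdot> w = u \<cdot> (v \<cdot> w)"
  by (simp add: fmult_def)

lemma fmult_rho_left [simp]: "rho u \<cdot> v = u \<cdot> v"
  and fmult_rho_right [simp]: "u \<cdot> rho v = u \<cdot> v"
  and rho_fmult [simp]: "rho (u \<cdot> v) = u \<cdot> v"
  and fmult_Nil_left [simp]: "[] \<cdot> u = rho u"
  and fmult_Nil_right [simp]: "u \<cdot> [] = rho u"
  by (simp_all add: fmult_def)

lemma winv_Nil [simp]: "winv [] = []"
  and winv_Cons: "winv (a # w) = winv w @ [flip a]"
  and winv_append: "winv (u @ v) = winv v @ winv u"
  by (simp_all add: winv_def)

lemma winv_winv [simp]: "winv (winv w) = w"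
  by (simp add: winv_def rev_map comp_def)

lemma rho_winv_cancel: "rho (w @ winv w @ v) = rho v"
proof (induction w arbitrary: v)
  case (Cons a w)
  have "rho ((a # w) @ winv (a # w) @ v) = push a (rho (w @ winv w @ flip a # v))"
    by (simp add: winv_Cons rho_Cons)
  also have "\<dots> = rho v"
    by (simp only: Cons.IH) (simp add: rho_Cons push_push_flip)
  finally show ?case .
qed simp

lemma fmult_winv_cancel [simp]: "w \<cdot> (winv w \<cdot> v) = rho v"
  by (simp add: fmult_def rho_winv_cancel)

lemma winv_fmult_cancel [simp]: "winv w \<cdot> (w \<cdot> v) = rho v"
  using fmult_winv_cancel[of "winv w"] by simp

lemma fmult_winv [simp]: "w \<cdot> winv w = []"
  and winv_fmult_self [simp]: "winv w \<cdot> w = []"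
  using fmult_winv_cancel[of w "[]"] winv_fmult_cancel[of w "[]"] by simp_all

lemma winv_rho: "winv (rho w) = rho (winv w)"
proof -
  \<comment> \<open>Reversing a reduced word and flipping its letters creates no cancelling pair.
    Hence \<open>rho\<close> fixes \<open>winv (rho w)\<close>, and both sides of the claim are the
    inverse of the same element.\<close>
  have r: "reduced (winv (rho w))"
    using reduced_rho[of w]
    unfolding reduced_def winv_def successively_rev successively_map
    by (rule successively_mono) auto
  have "winv (rho w) \<cdot> (w \<cdot> winv w) = winv (rho w) \<cdot> (rho w \<cdot> winv w)"
    by simp
  also have "\<dots> = rho (winv w)"
    by (rule winv_fmult_cancel)
  finally show ?thesis
    using r by (simp add: rho_reduced)
qed

lemma winv_fmult: "winv (u \<cdot> v) = winv v \<cdot> winv u"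
  by (simp add: fmult_def winv_rho winv_append)

lemma fmult_winv_rho [simp]: "u \<cdot> winv (rho v) = u \<cdot> winv v"
  and winv_rho_fmult [simp]: "winv (rho v) \<cdot> u = winv v \<cdot> u"
  by (simp_all add: winv_rho)

lemma one_free_group [simp]: "\<one>\<^bsub>free_group X\<^esub> = []"
  and mult_free_group [simp]: "mult (free_group X) = fmult"
  by (simp_all add: free_group_def)

lemma free_group_iff: "w \<in> carrier (free_group X) \<longleftrightarrow> w \<in> words X \<and> rho w = w"
  by (auto simp: free_group_def rho_reduced) (metis reduced_rho)

lemma free_group_words: "w \<in> carrier (free_group X) \<Longrightarrow> w \<in> words X"
  by (simp add: free_group_iff)

lemma rho_free_group [simp]: "w \<in> carrier (free_group X) \<Longrightarrow> rho w = w"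
  by (simp add: free_group_iff)

lemma rho_closed [simp]: "w \<in> words X \<Longrightarrow> rho w \<in> carrier (free_group X)"
  by (simp add: free_group_iff words_rho)

lemma fmult_closed [simp]: "u \<in> words X \<Longrightarrow> v \<in> words X \<Longrightarrow> u \<cdot> v \<in> carrier (free_group X)"
  by (simp add: fmult_def)

lemma winv_closed [simp]: "w \<in> carrier (free_group X) \<Longrightarrow> winv w \<in> carrier (free_group X)"
  by (metis free_group_iff winv_rho words_winv)

lemma Nil_closed [simp]: "[] \<in> carrier (free_group X)"
  by (simp add: free_group_iff)

lemma group_free_group: "group (free_group X)"
proof (rule groupI)
  fix x
  assume "x \<in> carrier (free_group X)"
  then show "\<exists>y\<in>carrier (free_group X). y \<otimes>\<^bsub>free_group X\<^esub> x = \<one>\<^bsub>free_group X\<^esub>"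
    by (intro bexI[of _ "winv x"]) simp_all
qed (simp_all add: free_group_words fmult_assoc)

lemma inv_free_group: "w \<in> carrier (free_group X) \<Longrightarrow> inv\<^bsub>free_group X\<^esub> w = winv w"
  by (rule group.inv_equality[OF group_free_group]) simp_all

section \<open>Normal closures\<close>

lemma (in group) normal_closure_normal:
  assumes "A \<subseteq> carrier G"
  shows "normal_closure G A \<lhd> G"
proof -
  \<comment> \<open>This makes the family of normal subgroups containing \<open>A\<close> nonempty,
    so that its intersection lies in the group.\<close>
  have "carrier G \<lhd> G"
    by (auto simp: normal_inv_iff subgroup_self)
  then have "subgroup (normal_closure G A) G"
    unfolding normal_closure_def using assms
    by (intro subgroups_Inter) (auto simp: normal_imp_subgroup)
  then show ?thesis
    by (auto simp: normal_inv_iff normal_closure_def)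
qed

lemma normal_closure_incl: "A \<subseteq> normal_closure G A"
  by (auto simp: normal_closure_def)

lemma normal_closure_least: "N \<lhd> G \<Longrightarrow> A \<subseteq> N \<Longrightarrow> normal_closure G A \<subseteq> N"
  by (auto simp: normal_closure_def)

section \<open>Homotopy of edge paths\<close>

lemma lsource_flip [simp]: "lsource K (flip a) = ltarget K a"
  and ltarget_flip [simp]: "ltarget K (flip a) = lsource K a"
  by (simp_all add: lsource_def ltarget_def flip_def)

lemma path_end_Nil [simp]: "path_end K (v, []) = v"
  and path_end_Cons [simp]: "path_end K (v, a # es) = path_end K (ltarget K a, es)"
  by (simp_all add: path_end_def)

lemma path_end_append [simp]:
  "path_end K (v, es @ fs) = path_end K (path_end K (v, es), fs)"
  by (induction es arbitrary: v) simp_all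

lemma walk_append [simp]:
  "walk K v (es @ fs) \<longleftrightarrow> walk K v es \<and> walk K (path_end K (v, es)) fs"
  by (induction es arbitrary: v) simp_all

lemma paths_iff [simp]: "(v, es) \<in> paths K \<longleftrightarrow> v \<in> verts K \<and> walk K v es"
  by (simp add: paths_def)

text \<open>The rule \<open>cell\<close> of \<open>homotopic\<close> forces the two sides of a
  2-cell to share only their start; \<open>cell_path_end\<close> adds the common end, so that
  homotopy fixes both endpoints.\<close>

locale cell_complex =
  fixes K :: "('v, 'e) complex2"
  assumes source_closed: "e \<in> edges K \<Longrightarrow> source K e \<in> verts K"
    and target_closed: "e \<in> edges K \<Longrightarrow> target K e \<in> verts K"
    and cell_path_end: "((w, cs), (w, ds)) \<in> cells K \<Longrightarrow> path_end K (w, cs) = path_end K (w, ds)"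
begin

lemma ltarget_closed: "fst a \<in> edges K \<Longrightarrow> ltarget K a \<in> verts K"
  by (simp add: ltarget_def source_closed target_closed)

lemma path_end_closed: "v \<in> verts K \<Longrightarrow> walk K v es \<Longrightarrow> path_end K (v, es) \<in> verts K"
  by (induction es arbitrary: v) (auto simp: ltarget_closed)

lemma homotopic_imp:
  "homotopic K P Q \<Longrightarrow>
    P \<in> paths K \<and> Q \<in> paths K \<and> fst P = fst Q \<and> path_end K P = path_end K Q"
  by (induction rule: homotopic.induct) (auto dest: cell_path_end)

lemma homotopic_append_right:
  assumes "homotopic K P Q" "walk K (path_end K P) fs"
  shows "homotopic K (fst P, snd P @ fs) (fst Q, snd Q @ fs)"
  using assms
proof (induction rule: homotopic.induct)
  case (refl P)
  then show ?case
    by (cases P) (auto intro: homotopic.refl)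
next
  case (sym P Q)
  then show ?case
    using homotopic_imp[OF sym(1)] by (intro homotopic.sym[OF sym(2)]) simp_all
next
  case (trans P Q T)
  then show ?case
    using homotopic_imp[OF trans(1)] by (intro homotopic.trans[OF trans(3,4)]) simp_all
next
  case (cancel v es a gs)
  then have "(v, es @ [a, flip a] @ gs @ fs) \<in> paths K"
    by auto
  then have "homotopic K (v, es @ [a, flip a] @ gs @ fs) (v, es @ gs @ fs)"
    by (rule homotopic.cancel)
  then show ?case
    by simp
next
  case (cell w cs ds v es gs)
  then show ?case
    using homotopic.cell[OF cell(1,2), of "gs @ fs"] cell_path_end[OF cell(1)] by simp
qed

lemma homotopic_append_left:
  assumes "homotopic K P Q" "v \<in> verts K" "walk K v es" "path_end K (v, es) = fst P"
  shows "homotopic K (v, es @ snd P) (v, es @ snd Q)"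
  using assms
proof (induction rule: homotopic.induct)
  case (refl P)
  then show ?case
    by (cases P) (auto intro: homotopic.refl)
next
  case (sym P Q)
  then show ?case
    using homotopic_imp[OF sym(1)] by (intro homotopic.sym[OF sym(2)]) simp_all
next
  case (trans P Q T)
  then show ?case
    using homotopic_imp[OF trans(1)] by (intro homotopic.trans[OF trans(3,4)]) simp_all
next
  case (cancel w fs a gs)
  then have "(v, (es @ fs) @ [a, flip a] @ gs) \<in> paths K"
    by auto
  then have "homotopic K (v, (es @ fs) @ [a, flip a] @ gs) (v, (es @ fs) @ gs)"
    by (rule homotopic.cancel)
  then show ?case
    by simp
next
  case (cell w cs ds v' fs gs)
  then show ?case
    using homotopic.cell[OF cell(1), of v "es @ fs" gs] by simp
qed

section \<open>Homotopy classes and their composition\<close>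

lemma hclass_eq_iff: "P \<in> paths K \<Longrightarrow> hclass K P = hclass K Q \<longleftrightarrow> homotopic K P Q"
  unfolding hclass_def using homotopic.refl homotopic.sym homotopic.trans by blast

lemma hclass_self: "P \<in> paths K \<Longrightarrow> P \<in> hclass K P"
  by (simp add: hclass_def homotopic.refl)

text \<open>Operations on classes are defined as unions over all representatives. When the result
  does not depend on the representative, the union collapses to that result, as a class of a path is
  nonempty.\<close>

lemma hclass_UN:
  assumes "P \<in> paths K" "\<And>Q. homotopic K P Q \<Longrightarrow> f Q = A"
  shows "(\<Union>Q\<in>hclass K P. f Q) = A"
  using homotopic.refl[OF assms(1)] assms(2) unfolding hclass_def by blast

lemma mdom_hclass: "P \<in> paths K \<Longrightarrow> mdom (hclass K P) = fst P"
proof -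
  assume P: "P \<in> paths K"
  have "fst ` hclass K P = {fst P}"
    using hclass_self[OF P] homotopic_imp by (fastforce simp: hclass_def)
  then show ?thesis
    by (simp add: mdom_def)
qed

lemma mran_hclass: "P \<in> paths K \<Longrightarrow> mran K (hclass K P) = path_end K P"
proof -
  assume P: "P \<in> paths K"
  have "path_end K ` hclass K P = {path_end K P}"
  proof (intro equalityI subsetI)
    fix x
    assume "x \<in> path_end K ` hclass K P"
    then obtain Q where "homotopic K P Q" "x = path_end K Q"
      by (auto simp: hclass_def)
    then show "x \<in> {path_end K P}"
      using homotopic_imp[of P Q] by simp
  qed (use hclass_self[OF P] in auto)
  then show ?thesis
    by (simp add: mran_def)
qed

lemma mcomp_hclass:
  assumes P: "P \<in> paths K" and Q: "Q \<in> paths K" and PQ: "path_end K P = fst Q"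
  shows "mcomp K (hclass K P) (hclass K Q) = hclass K (fst P, snd P @ snd Q)"
  unfolding mcomp_def
proof (intro hclass_UN P Q)
  fix P' Q'
  assume *: "homotopic K P P'" "homotopic K Q Q'"
  then have P': "P' \<in> paths K" "fst P' = fst P" "path_end K P' = fst Q"
    and Q': "Q' \<in> paths K" "fst Q' = fst Q"
    using homotopic_imp PQ by metis+
  \<comment> \<open>The representatives are exchanged one factor at a time, by way of
    \<open>P'\<close> followed by \<open>Q\<close>.\<close>
  have "homotopic K (fst P, snd P @ snd Q) (fst P', snd P' @ snd Q)"
    using *(1) Q PQ by (intro homotopic_append_right) (auto simp: paths_def)
  moreover have "homotopic K (fst P', snd P' @ snd Q) (fst P', snd P' @ snd Q')"
    using *(2) P' by (intro homotopic_append_left) (auto simp: paths_def)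
  ultimately have h: "homotopic K (fst P, snd P @ snd Q) (fst P', snd P' @ snd Q')"
    by (rule homotopic.trans)
  then show "hclass K (fst P', snd P' @ snd Q') = hclass K (fst P, snd P @ snd Q)"
    using hclass_eq_iff homotopic_imp by metis
qed

end

section \<open>Paths in the Squier complex\<close>

definition edge_lact :: "'x word \<Rightarrow> 'x edge letter \<Rightarrow> 'x edge letter" where
  "edge_lact u = (\<lambda>((p, l, r, q), b). ((u \<cdot> p, l, r, q), b))"

lemma edge_letter_cases:
  obtains p l r q b where "a = ((p, l, r, q), b)"
  by (cases a) auto

lemma path_lact_eq: "path_lact u (v, es) = (u \<cdot> v, map (edge_lact u) es)"
  by (simp add: path_lact_def edge_lact_def)

lemma edge_lact_simp [simp]: "edge_lact u ((p, l, r, q), b) = ((u \<cdot> p, l, r, q), b)"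
  by (simp add: edge_lact_def)

lemma edge_lact_edge_lact [simp]: "edge_lact u (edge_lact v a) = edge_lact (u \<cdot> v) a"
  by (auto simp: edge_lact_def fmult_assoc split: prod.splits)

lemma edge_lact_flip: "edge_lact u (flip a) = flip (edge_lact u a)"
  by (auto simp: edge_lact_def flip_def split: prod.splits)

locale squier_complex =
  fixes X :: "'x set" and R :: "('x word \<times> 'x word) set"
  assumes presentation: "group_presentation X R"
begin

abbreviation F :: "'x word monoid" where
  "F \<equiv> free_group X"

abbreviation K :: "('x word, 'x edge) complex2" where
  "K \<equiv> squier X R"

lemma R_words [simp]:
  assumes "(l, r) \<in> R"
  shows "l \<in> words X" "r \<in> words X"
  using presentation assms by (auto simp: group_presentation_def)

lemma verts_squier [simp]: "verts K = carrier F"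
  by (simp add: squier_def)

lemma source_squier [simp]: "source K (p, l, r, q) = p \<cdot> (l \<cdot> q)"
  and target_squier [simp]: "target K (p, l, r, q) = p \<cdot> (r \<cdot> q)"
  by (simp_all add: squier_def fmult_assoc)

lemma edges_squier [simp]:
  "(p, l, r, q) \<in> edges K \<longleftrightarrow> p \<in> carrier F \<and> (l, r) \<in> R \<and> q \<in> carrier F"
  by (simp add: squier_def)

text \<open>The 2-cells in the form used for computation: products are bracketed to the right, and
  \<open>rho\<close> is absorbed by the multiplication.\<close>

lemma cell_squier:
  assumes "(l, r) \<in> R" "(l', r') \<in> R"
    and "p \<in> carrier F" "q \<in> carrier F" "p' \<in> carrier F" "q' \<in> carrier F"
  shows "((p \<cdot> (l \<cdot> (q \<cdot> (p' \<cdot> (l' \<cdot> q')))),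
          [((p, l, r, q \<cdot> (p' \<cdot> (l' \<cdot> q'))), True), ((p \<cdot> (r \<cdot> (q \<cdot> p')), l', r', q'), True)]),
         (p \<cdot> (l \<cdot> (q \<cdot> (p' \<cdot> (l' \<cdot> q')))),
          [((p \<cdot> (l \<cdot> (q \<cdot> p')), l', r', q'), True), ((p, l, r, q \<cdot> (p' \<cdot> (r' \<cdot> q'))), True)]))
    \<in> cells K"
  unfolding squier_def using assms
  by (simp, intro exI[of _ p] exI[of _ l] exI[of _ r] exI[of _ q] exI[of _ p'] exI[of _ l']
      exI[of _ r'] exI[of _ q']) (simp add: fmult_assoc)

lemma cell_squierE:
  assumes "((w, cs), (w', ds)) \<in> cells K"
  obtains p l r q p' l' r' q' where
    "(l, r) \<in> R" "(l', r') \<in> R"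
    "p \<in> carrier F" "q \<in> carrier F" "p' \<in> carrier F" "q' \<in> carrier F"
    "w = p \<cdot> (l \<cdot> (q \<cdot> (p' \<cdot> (l' \<cdot> q'))))" "w' = w"
    "cs = [((p, l, r, q \<cdot> (p' \<cdot> (l' \<cdot> q'))), True), ((p \<cdot> (r \<cdot> (q \<cdot> p')), l', r', q'), True)]"
    "ds = [((p \<cdot> (l \<cdot> (q \<cdot> p')), l', r', q'), True), ((p, l, r, q \<cdot> (p' \<cdot> (r' \<cdot> q'))), True)]"
  using assms unfolding squier_def by (auto simp: fmult_assoc)

text \<open>Both sides of a 2-cell perform the same two rewritings at disjoint places, hence end at
  the product of \<open>p\<close>, \<open>r\<close>, \<open>q\<close>, \<open>p'\<close>,
  \<open>r'\<close>, \<open>q'\<close>.\<close>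

sublocale cell_complex K
proof
  fix e
  assume e: "e \<in> edges K"
  then obtain p l r q where "e = (p, l, r, q)"
    by (cases e)
  with e show "source K e \<in> verts K" "target K e \<in> verts K"
    by (auto simp: free_group_words)
next
  fix w cs ds
  assume "((w, cs), (w, ds)) \<in> cells K"
  then show "path_end K (w, cs) = path_end K (w, ds)"
    by (rule cell_squierE) (simp add: ltarget_def fmult_assoc)
qed

section \<open>Translation of paths and homotopy classes\<close>

lemma lsource_lact [simp]: "lsource K (edge_lact u a) = u \<cdot> lsource K a"
  by (cases a rule: edge_letter_cases) (simp add: lsource_def fmult_assoc)

lemma ltarget_lact [simp]: "ltarget K (edge_lact u a) = u \<cdot> ltarget K a"
  by (cases a rule: edge_letter_cases) (simp add: ltarget_def fmult_assoc)

lemma edge_lact_closed: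
  "u \<in> carrier F \<Longrightarrow> fst a \<in> edges K \<Longrightarrow> fst (edge_lact u a) \<in> edges K"
  by (cases "a"; cases "fst a") (auto simp: edge_lact_def free_group_words)

text \<open>The product \<open>[] \<cdot> p\<close> is \<open>rho p\<close>, which is
  \<open>p\<close> only because the first component of an edge is reduced.\<close>

lemma edge_lact_Nil: "fst a \<in> edges K \<Longrightarrow> edge_lact [] a = a"
  by (cases "a"; cases "fst a") (auto simp: edge_lact_def)

lemma walk_lact:
  "u \<in> carrier F \<Longrightarrow> walk K v es \<Longrightarrow> walk K (u \<cdot> v) (map (edge_lact u) es)"
  by (induction es arbitrary: v) (auto simp: edge_lact_closed)

lemma path_end_lact: "path_end K (u \<cdot> v, map (edge_lact u) es) = u \<cdot> path_end K (v, es)"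
  by (induction es arbitrary: v) simp_all

text \<open>A left translate of a 2-cell is the 2-cell with \<open>u \<cdot> p\<close> in place of
  \<open>p\<close> and all other parameters unchanged.\<close>

lemma cell_lact:
  assumes "u \<in> carrier F" "((w, cs), (w', ds)) \<in> cells K"
  shows "((u \<cdot> w, map (edge_lact u) cs), (u \<cdot> w', map (edge_lact u) ds)) \<in> cells K"
  using assms(2)
proof (elim cell_squierE)
  fix p l r q p' l' r' q'
  assume "(l, r) \<in> R" "(l', r') \<in> R"
    "p \<in> carrier F" "q \<in> carrier F" "p' \<in> carrier F" "q' \<in> carrier F"
    "w = p \<cdot> (l \<cdot> (q \<cdot> (p' \<cdot> (l' \<cdot> q'))))" "w' = w"
    "cs = [((p, l, r, q \<cdot> (p' \<cdot> (l' \<cdot> q'))), True), ((p \<cdot> (r \<cdot> (q \<cdot> p')), l', r', q'), True)]"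
    "ds = [((p \<cdot> (l \<cdot> (q \<cdot> p')), l', r', q'), True), ((p, l, r, q \<cdot> (p' \<cdot> (r' \<cdot> q'))), True)]"
  then show ?thesis
    using cell_squier[of l r l' r' "u \<cdot> p" q p' q'] assms(1)
    by (simp add: fmult_assoc free_group_words)
qed

lemma homotopic_lact:
  assumes "homotopic K P Q" and u: "u \<in> carrier F"
  shows "homotopic K (path_lact u P) (path_lact u Q)"
  using assms(1)
proof (induction rule: homotopic.induct)
  case (refl P)
  then show ?case
    using u by (cases P) (auto simp: path_lact_eq walk_lact free_group_words intro!: homotopic.refl)
next
  case (cancel v es a fs)
  then have v: "v \<in> carrier F" and "walk K v (es @ [a, flip a] @ fs)"
    by auto
  then have "walk K (u \<cdot> v) (map (edge_lact u) (es @ [a, flip a] @ fs))"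
    using u by (intro walk_lact)
  then have "walk K (u \<cdot> v)
      (map (edge_lact u) es @ [edge_lact u a, flip (edge_lact u a)] @ map (edge_lact u) fs)"
    by (simp only: map_append list.map edge_lact_flip)
  then have "(u \<cdot> v,
      map (edge_lact u) es @ [edge_lact u a, flip (edge_lact u a)] @ map (edge_lact u) fs)
      \<in> paths K"
    using u v by (simp add: free_group_words del: walk_append)
  from homotopic.cancel[OF this] show ?case
    by (simp add: path_lact_eq edge_lact_flip)
next
  case (cell w cs ds v es fs)
  have "homotopic K
     (u \<cdot> v, map (edge_lact u) es @ map (edge_lact u) cs @ map (edge_lact u) fs)
     (u \<cdot> v, map (edge_lact u) es @ map (edge_lact u) ds @ map (edge_lact u) fs)"
    using cell u walk_lact[OF u, of v "es @ cs @ fs"] walk_lact[OF u, of v "es @ ds @ fs"]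
    by (intro homotopic.cell[OF cell_lact[OF u cell(1)]])
      (simp_all add: path_end_lact free_group_words)
  then show ?case
    by (simp add: path_lact_eq)
next
  case (sym P Q)
  from sym.IH show ?case
    by (rule homotopic.sym)
next
  case (trans P Q T)
  from trans.IH show ?case
    by (rule homotopic.trans)
qed

lemma lact_hclass:
  assumes "P \<in> paths K" "u \<in> carrier F"
  shows "lact K u (hclass K P) = hclass K (path_lact u P)"
  unfolding lact_def
proof (intro hclass_UN assms)
  fix Q
  assume "homotopic K P Q"
  then have "homotopic K (path_lact u P) (path_lact u Q)"
    using assms(2) by (rule homotopic_lact)
  then show "hclass K (path_lact u Q) = hclass K (path_lact u P)"
    using hclass_eq_iff homotopic_imp by metis
qed

lemma path_ract_Nil: "P \<in> paths K \<Longrightarrow> path_ract P [] = P"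
proof -
  have "walk K v es \<Longrightarrow> map (\<lambda>((p, l, r, q), b). ((p, l, r, q \<cdot> []), b)) es = es" for v es
    by (induction es arbitrary: v) auto
  then show "P \<in> paths K \<Longrightarrow> path_ract P [] = P"
    by (cases P) (auto simp: path_ract_def)
qed

text \<open>In the product of the star group the second factor starts at \<open>1\<close>, so the
  first factor is translated on the right by \<open>[]\<close>, which fixes every
  representative.\<close>

lemma ract_hclass_Nil:
  assumes "P \<in> paths K"
  shows "ract K (hclass K P) [] = hclass K P"
  unfolding ract_def
proof (intro hclass_UN assms)
  fix Q
  assume "homotopic K P Q"
  then show "hclass K (path_ract Q []) = hclass K P"
    using hclass_eq_iff homotopic_imp path_ract_Nil by metis
qed

text \<open>Every edge is a left translate of exactly one edge starting at \<open>1\<close>, its label. Hence a path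
  is determined by its start and its sequence of labels.\<close>

definition label :: "'x edge letter \<Rightarrow> 'x edge letter" where
  "label a = edge_lact (winv (source K (fst a))) a"

text \<open>The path from \<open>g\<close> with a given label sequence. A letter
  \<open>(e, False)\<close> with \<open>e\<close> in \<open>S1\<close> starts at the target of
  \<open>e\<close>, not at \<open>1\<close>; hence the correction by
  \<open>winv (lsource K a)\<close>, which is trivial for positive letters.\<close>

primrec lift :: "'x word \<Rightarrow> 'x edge word \<Rightarrow> 'x edge letter list" where
  "lift g [] = []"
| "lift g (a # w) =
    (let a' = edge_lact (g \<cdot> winv (lsource K a)) a in a' # lift (ltarget K a') w)"

abbreviation S :: "'x edge set" where
  "S \<equiv> S1 X R"

lemma S_edges: "e \<in> S \<Longrightarrow> e \<in> edges K"
  and S_source: "e \<in> S \<Longrightarrow> source K e = []"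
  by (simp_all add: S1_def)

text \<open>Translating by the inverse of the source plq turns \<open>p\<close> into q^-1 l^-1 p^-1
  p, so the label no longer remembers \<open>p\<close>.\<close>

lemma label_edge:
  assumes "(l, r) \<in> R" "q \<in> carrier F"
  shows "label ((p, l, r, q), b) = (lam X l r q, b)"
  using assms by (simp add: label_def lam_def inv_free_group winv_fmult fmult_assoc)

lemma label_mem:
  assumes "fst a \<in> edges K"
  shows "label a \<in> S \<times> UNIV"
proof -
  obtain p l r q b where a: "a = ((p, l, r, q), b)"
    by (rule edge_letter_cases)
  then have "(l, r) \<in> R" "q \<in> carrier F"
    using assms by simp_all
  then show ?thesis
    using a by (simp add: label_edge S1_def lam_def inv_free_group free_group_words fmult_assoc)
qed

lemma words_label: "walk K v es \<Longrightarrow> map label es \<in> words S"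
  by (induction es arbitrary: v) (auto intro!: label_mem)

lemma label_lact [simp]: "label (edge_lact u a) = label a"
  by (cases a rule: edge_letter_cases) (simp add: label_def winv_fmult fmult_assoc)

lemma label_S: "fst a \<in> S \<Longrightarrow> label a = a"
  by (simp add: label_def S_source S_edges edge_lact_Nil)

lemma label_flip [simp]: "label (flip a) = flip (label a)"
  by (simp add: label_def edge_lact_flip)

lemma map_label_lift: "w \<in> words S \<Longrightarrow> map label (lift g w) = w"
  by (induction w arbitrary: g) (auto simp: Let_def label_S)

lemma lsource_closed: "fst a \<in> edges K \<Longrightarrow> lsource K a \<in> carrier F"
  using source_closed target_closed by (simp add: lsource_def)

lemma ltarget_closed': "fst a \<in> edges K \<Longrightarrow> ltarget K a \<in> carrier F"
  using ltarget_closed by simp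

lemma walk_lift: "g \<in> carrier F \<Longrightarrow> w \<in> words S \<Longrightarrow> walk K g (lift g w)"
proof (induction w arbitrary: g)
  case (Cons a w)
  then have "fst a \<in> edges K"
    by (auto intro: S_edges)
  then show ?case
    using Cons
    by (auto simp: Let_def edge_lact_closed fmult_assoc lsource_closed ltarget_closed'
        free_group_words)
qed simp

lemma lift_map_label: "v \<in> carrier F \<Longrightarrow> walk K v es \<Longrightarrow> lift v (map label es) = es"
proof (induction es arbitrary: v)
  case (Cons a es)
  let ?s = "source K (fst a)"
  from Cons.prems have a: "fst a \<in> edges K" and v: "lsource K a = v"
    by auto
  \<comment> \<open>With s the source of the underlying edge, \<open>label a\<close> is the
    translate of \<open>a\<close> by s^-1 and starts at s^-1 v. The two translations compose to v
    (s^-1 v)^-1 s^-1 = v v^-1 = 1.\<close>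
  have "edge_lact (v \<cdot> winv (lsource K (label a))) (label a) = edge_lact (v \<cdot> winv v) a"
    by (simp add: label_def winv_fmult fmult_assoc v)
  also have "\<dots> = a"
    using a by (simp add: edge_lact_Nil)
  finally show ?case
    using Cons ltarget_closed'[OF a] by (simp add: Let_def)
qed simp

lemma lift_append: "lift g (u @ w) = lift g u @ lift (path_end K (g, lift g u)) w"
  by (induction u arbitrary: g) (simp_all add: Let_def)

text \<open>Moving the start of a path with fixed labels translates the whole path. This is what
  turns the product \<open>*\<close> into concatenation of words.\<close>

lemma lift_fmult: "lift (h \<cdot> g) w = map (edge_lact h) (lift g w)"
  by (induction w arbitrary: g) (simp_all add: Let_def fmult_assoc)

text \<open>The lifts of \<open>a\<close> and \<open>flip a\<close> traverse one edge back and forth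
  and return to \<open>rho g\<close>, which is \<open>g\<close> by the assumption, so
  \<open>w\<close> is lifted from \<open>g\<close> as before.\<close>

lemma lift_cancel:
  assumes "g \<in> carrier F"
  shows "\<exists>a'. lift g (a # flip a # w) = a' # flip a' # lift g w"
  using assms by (simp add: Let_def fmult_assoc edge_lact_flip)

section \<open>The group of homotopy classes of paths starting at 1\<close>

abbreviation star :: "('x word, 'x edge) path set monoid" where
  "star \<equiv> star1 X R"

text \<open>Evaluation of words in the star group, defined through paths so that it is available
  before the group laws are known. \<open>free_lift_star\<close> identifies it with the homomorphism
  from the free group.\<close>

definition word_class :: "'x edge word \<Rightarrow> ('x word, 'x edge) path set" where
  "word_class w = hclass K ([], lift [] w)"

lemma lift_paths: "w \<in> words S \<Longrightarrow> ([], lift [] w) \<in> paths K"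
  by (simp add: walk_lift)

lemma carrier_star: "carrier star = word_class ` words S"
proof (intro equalityI subsetI)
  fix \<alpha>
  assume "\<alpha> \<in> carrier star"
  then obtain v es where "(v, es) \<in> paths K" "\<alpha> = hclass K (v, es)" "mdom \<alpha> = []"
    by (auto simp: star1_def hclasses_def)
  moreover from this have "v = []"
    by (simp add: mdom_hclass)
  \<comment> \<open>A path from \<open>1\<close> is the lift of its own label sequence.\<close>
  ultimately have "map label es \<in> words S" "\<alpha> = word_class (map label es)"
    by (auto simp: word_class_def lift_map_label words_label)
  then show "\<alpha> \<in> word_class ` words S"
    by blast
next
  fix \<alpha>
  assume "\<alpha> \<in> word_class ` words S"
  then show "\<alpha> \<in> carrier star"
    using lift_paths by (auto simp: star1_def hclasses_def word_class_def mdom_hclass)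
qed

lemma word_class_closed [simp]: "w \<in> words S \<Longrightarrow> word_class w \<in> carrier star"
  by (simp add: carrier_star)

lemma one_star: "\<one>\<^bsub>star\<^esub> = word_class []"
  by (simp add: star1_def word_class_def)

lemma word_class_append:
  assumes "u \<in> words S" "w \<in> words S"
  shows "word_class u \<otimes>\<^bsub>star\<^esub> word_class w = word_class (u @ w)"
proof -
  let ?P = "([], lift [] u)" and ?Q = "([], lift [] w)"
  let ?g = "path_end K ?P"
  have P: "?P \<in> paths K" and Q: "?Q \<in> paths K"
    using assms lift_paths by blast+
  have g: "?g \<in> carrier F"
    using P path_end_closed by simp
  have "?g \<cdot> [] = ?g"
    using g by simp
  \<comment> \<open>Translated to the end \<open>?g\<close> of the first path, the path of
    \<open>w\<close> becomes the lift of \<open>w\<close> from \<open>?g\<close>, which is the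
    second half of the lift of \<open>u @ w\<close>.\<close>
  then have Q': "path_lact ?g ?Q = (?g, lift ?g w)"
    using lift_fmult[of ?g "[]" w] by (simp add: path_lact_eq)
  have "word_class u \<otimes>\<^bsub>star\<^esub> word_class w
      = mcomp K (hclass K ?P) (hclass K (?g, lift ?g w))"
    using P Q g Q'
    by (simp add: star1_def word_class_def mdom_hclass mran_hclass ract_hclass_Nil lact_hclass
        del: paths_iff)
  also have "\<dots> = word_class (u @ w)"
    using P g assms by (subst mcomp_hclass) (simp_all add: word_class_def lift_append walk_lift)
  finally show ?thesis .
qed

lemma word_class_cancel:
  assumes "u \<in> words S" "a \<in> S \<times> UNIV" "w \<in> words S"
  shows "word_class (u @ a # flip a # w) = word_class (u @ w)"
proof -
  let ?g = "path_end K ([], lift [] u)"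
  have "?g \<in> carrier F"
    using path_end_closed lift_paths[OF assms(1)] by simp
  then obtain a' where a': "lift ?g (a # flip a # w) = a' # flip a' # lift ?g w"
    using lift_cancel by blast
  then have eq: "lift [] (u @ a # flip a # w) = lift [] u @ [a', flip a'] @ lift ?g w"
    by (simp only: lift_append append.simps)
  have "([], lift [] (u @ a # flip a # w)) \<in> paths K"
    using assms by (intro lift_paths) auto
  then have "homotopic K ([], lift [] (u @ a # flip a # w)) ([], lift [] (u @ w))"
    unfolding eq lift_append[of _ u w] by (rule homotopic.cancel)
  then show ?thesis
    unfolding word_class_def using hclass_eq_iff homotopic_imp by metis
qed

lemma word_class_winv: "w \<in> words S \<Longrightarrow> word_class (winv w @ w) = word_class []"
proof (induction w)
  case (Cons a w)
  then show ?case
    using word_class_cancel[of "winv w" "flip a" w] by (simp add: winv_Cons)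
qed simp

text \<open>Every class comes from a word, so associativity and the unit law are inherited from
  concatenation; an inverse is given by the formal inverse word, whose concatenation with the word
  contracts.\<close>

lemma group_star: "group star"
proof (rule groupI)
  fix x
  assume "x \<in> carrier star"
  then obtain w where "w \<in> words S" "x = word_class w"
    by (auto simp: carrier_star)
  then show "\<exists>y\<in>carrier star. y \<otimes>\<^bsub>star\<^esub> x = \<one>\<^bsub>star\<^esub>"
    by (intro bexI[of _ "word_class (winv w)"])
      (simp_all add: word_class_append word_class_winv one_star)
qed (auto simp: carrier_star word_class_append one_star)

interpretation star: group star
  by (rule group_star)

lemma word_class_push:
  assumes "a \<in> S \<times> UNIV" "w \<in> words S"
  shows "word_class (push a w) = word_class (a # w)"
proof (cases w)
  case (Cons b w')
  then show ?thesis
    using assms word_class_cancel[of "[]" a w'] by simp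
qed simp

lemma word_class_rho: "w \<in> words S \<Longrightarrow> word_class (rho w) = word_class w"
proof (induction w)
  case (Cons a w)
  have "word_class (rho (a # w)) = word_class [a] \<otimes>\<^bsub>star\<^esub> word_class (rho w)"
    using Cons.prems by (simp add: rho_Cons word_class_push word_class_append words_rho)
  also have "\<dots> = word_class (a # w)"
    using Cons by (simp add: word_class_append)
  finally show ?case .
qed simp

lemma word_class_True:
  assumes "e \<in> S"
  shows "word_class [(e, True)] = edge_class X R e"
  using assms S_source[OF assms] edge_lact_Nil[of "(e, True)"]
  by (simp add: word_class_def edge_class_def lsource_def S_edges)

lemma word_class_False:
  assumes "e \<in> S"
  shows "word_class [(e, False)] = inv\<^bsub>star\<^esub> (edge_class X R e)"
  using assms word_class_winv[of "[(e, True)]"]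
  by (intro star.inv_equality[symmetric])
    (simp_all add: word_class_append one_star winv_Cons flip_def flip: word_class_True)

section \<open>The homomorphism from the free group on the edges at 1\<close>

lemma free_lift_star: "w \<in> words S \<Longrightarrow> free_lift star (edge_class X R) w = word_class w"
proof (induction w)
  case Nil
  then show ?case
    by (simp add: free_lift_def one_star)
next
  case (Cons a w)
  obtain e b where a: "a = (e, b)"
    by fastforce
  have "free_lift star (edge_class X R) (a # w) = word_class [a] \<otimes>\<^bsub>star\<^esub> word_class w"
    using Cons a by (simp add: free_lift_def word_class_True word_class_False)
  also have "\<dots> = word_class (a # w)"
    using Cons.prems by (simp add: word_class_append)
  finally show ?case .
qed

lemma free_lift_hom: "free_lift star (edge_class X R) \<in> hom (free_group S) star"
  by (rule homI)
    (simp_all add: free_lift_star free_group_words fmult_def word_class_rho word_class_append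
      words_rho)

lemma generate_star: "generate star (edge_class X R ` S) = carrier star"
proof (intro equalityI subsetI)
  have "edge_class X R ` S \<subseteq> carrier star"
    by (auto simp flip: word_class_True)
  then show "x \<in> generate star (edge_class X R ` S) \<Longrightarrow> x \<in> carrier star" for x
    using star.generate_in_carrier by blast
  have "word_class w \<in> generate star (edge_class X R ` S)" if "w \<in> words S" for w
    using that
  proof (induction w)
    case Nil
    then show ?case
      using generate.one[of star] by (simp add: one_star)
  next
    case (Cons a w)
    obtain e b where a: "a = (e, b)" "e \<in> S"
      using Cons.prems by (cases a) auto
    then have "word_class [a] \<in> generate star (edge_class X R ` S)"
      by (cases b) (auto simp: word_class_True word_class_False intro: generate.incl generate.inv)
    then have "word_class [a] \<otimes>\<^bsub>star\<^esub> word_class w \<in> generate star (edge_class X R ` S)"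
      using Cons by (intro generate.eng) auto
    then show ?case
      using Cons.prems by (simp add: word_class_append)
  qed
  then show "x \<in> carrier star \<Longrightarrow> x \<in> generate star (edge_class X R ` S)" for x
    by (auto simp: carrier_star)
qed

section \<open>The defining relations\<close>

definition relations :: "('x edge word \<times> 'x edge word) set" where
  "relations =
    {(gen (lam X l r (v \<cdot> rho s \<cdot> u)) \<cdot> gen (lam X s d u),
      gen (lam X s d u) \<cdot> gen (lam X l r (v \<cdot> rho d \<cdot> u))) | l r s d u v.
      (l, r) \<in> R \<and> (s, d) \<in> R \<and> u \<in> carrier F \<and> v \<in> carrier F}"

definition relators :: "'x edge word set" where
  "relators = {a \<otimes>\<^bsub>free_group S\<^esub> inv\<^bsub>free_group S\<^esub> b | a b. (a, b) \<in> relations}"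

lemma lam_S: "(l, r) \<in> R \<Longrightarrow> q \<in> carrier F \<Longrightarrow> lam X l r q \<in> S"
  using label_mem[of "(([], l, r, q), True)"] by (simp add: label_edge)

lemma gen_words: "e \<in> S \<Longrightarrow> gen e \<in> words S"
  by (simp add: gen_def)

lemma relations_closed: "relations \<subseteq> carrier (free_group S) \<times> carrier (free_group S)"
  by (auto simp: relations_def intro!: fmult_closed gen_words lam_S simp: free_group_words)

text \<open>Since labels forget the leftmost component, the two sides of a 2-cell read as the
  relation with \<open>v = q \<cdot> p'\<close>, \<open>u = q'\<close> and
  \<open>(s, d) = (l', r')\<close>.\<close>

lemma cell_relation:
  assumes "((w, cs), (w', ds)) \<in> cells K"
  shows "(rho (map label cs), rho (map label ds)) \<in> relations"
  using assms
proof (elim cell_squierE)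
  fix p l r q p' l' r' q'
  assume *: "(l, r) \<in> R" "(l', r') \<in> R"
    "p \<in> carrier F" "q \<in> carrier F" "p' \<in> carrier F" "q' \<in> carrier F"
    "cs = [((p, l, r, q \<cdot> (p' \<cdot> (l' \<cdot> q'))), True), ((p \<cdot> (r \<cdot> (q \<cdot> p')), l', r', q'), True)]"
    "ds = [((p \<cdot> (l \<cdot> (q \<cdot> p')), l', r', q'), True), ((p, l, r, q \<cdot> (p' \<cdot> (r' \<cdot> q'))), True)]"
  have c: "q \<cdot> (p' \<cdot> (l' \<cdot> q')) \<in> carrier F"
    "q \<cdot> (p' \<cdot> (r' \<cdot> q')) \<in> carrier F"
    "q \<cdot> p' \<in> carrier F"
    using *(1-6) by (simp_all add: free_group_words)
  have "rho (map label cs)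
      = gen (lam X l r (q \<cdot> p' \<cdot> rho l' \<cdot> q')) \<cdot> gen (lam X l' r' q')"
    using *(1-6) c by (simp add: *(7) label_edge fmult_assoc) (simp add: fmult_def gen_def)
  moreover have "rho (map label ds)
      = gen (lam X l' r' q') \<cdot> gen (lam X l r (q \<cdot> p' \<cdot> rho r' \<cdot> q'))"
    using *(1-6) c by (simp add: *(8) label_edge fmult_assoc) (simp add: fmult_def gen_def)
  ultimately show ?thesis
    unfolding relations_def using *(1,2,6) c(3) by blast
qed

text \<open>Conversely, the two sides of each relation are the label sequences of the two sides of a
  2-cell based at \<open>1\<close>.\<close>

lemma relation_word_class:
  assumes "(a, b) \<in> relations"
  shows "word_class a = word_class b"
proof -
  obtain l r s d u v where *: "(l, r) \<in> R" "(s, d) \<in> R" "u \<in> carrier F" "v \<in> carrier F"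
    and a: "a = rho [(lam X l r (v \<cdot> (s \<cdot> u)), True), (lam X s d u, True)]"
    and b: "b = rho [(lam X s d u, True), (lam X l r (v \<cdot> (d \<cdot> u)), True)]"
    using assms by (auto simp: relations_def fmult_assoc) (auto simp: fmult_def gen_def)
  \<comment> \<open>The labels leave \<open>p\<close> free; this choice puts the start of the 2-cell
    at \<open>1\<close>.\<close>
  define p where "p = winv (l \<cdot> (v \<cdot> (s \<cdot> u)))"
  have p: "p \<in> carrier F" "p \<cdot> (l \<cdot> (v \<cdot> (s \<cdot> u))) = []"
    using * by (simp_all add: p_def free_group_words)
  define cs where "cs = [((p, l, r, v \<cdot> (s \<cdot> u)), True), ((p \<cdot> (r \<cdot> v), s, d, u), True)]"
  define ds where "ds = [((p \<cdot> (l \<cdot> v), s, d, u), True), ((p, l, r, v \<cdot> (d \<cdot> u)), True)]"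
  \<comment> \<open>A 2-cell determines \<open>v\<close> only as the product of its \<open>q\<close>
    and \<open>p'\<close>; here they are \<open>v\<close> and \<open>[]\<close>.\<close>
  have cell: "(([], cs), ([], ds)) \<in> cells K"
    using cell_squier[OF *(1,2) p(1) *(4) Nil_closed *(3)] * p(2) by (simp add: cs_def ds_def)
  have walk: "walk K [] cs" "walk K [] ds"
    using * p by (simp_all add: cs_def ds_def lsource_def ltarget_def free_group_words fmult_assoc)
  then have "homotopic K ([], cs) ([], ds)"
    using homotopic.cell[OF cell, of "[]" "[]" "[]"] by simp
  then have "word_class (map label cs) = word_class (map label ds)"
    using walk by (simp add: word_class_def lift_map_label hclass_eq_iff)
  moreover have "a = rho (map label cs)" "b = rho (map label ds)"
    using * by (simp_all add: a b cs_def ds_def label_edge free_group_words)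
  ultimately show ?thesis
    using walk by (simp add: word_class_rho words_label)
qed

section \<open>The kernel as the normal closure of the relators\<close>

interpretation FS: group "free_group S"
  rewrites "mult (free_group S) = fmult" and "one (free_group S) = []"
  by (simp_all add: group_free_group)

interpretation FS_star: group_hom "free_group S" star "free_lift star (edge_class X R)"
  by (intro group_hom.intro group_free_group group_star group_hom_axioms.intro free_lift_hom)

abbreviation N :: "'x edge word set" where
  "N \<equiv> normal_closure (free_group S) relators"

lemma relators_closed: "relators \<subseteq> carrier (free_group S)"
proof
  fix x
  assume "x \<in> relators"
  then obtain a b where "(a, b) \<in> relations" "x = a \<cdot> inv\<^bsub>free_group S\<^esub> b"
    by (auto simp: relators_def)
  then show "x \<in> carrier (free_group S)"
    using relations_closed FS.inv_closed by (auto simp: free_group_words)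
qed

lemma N_normal: "N \<lhd> free_group S"
  using group.normal_closure_normal[OF group_free_group relators_closed] .

lemma N_subgroup: "subgroup N (free_group S)"
  using N_normal by (rule normal_imp_subgroup)

text \<open>The value of a word in the quotient of the free group by \<open>N\<close>. Label
  sequences of paths need not be reduced, hence \<open>rho\<close>.\<close>

definition coset :: "'x edge word \<Rightarrow> 'x edge word set" where
  "coset w = N #>\<^bsub>free_group S\<^esub> rho w"

lemma coset_append:
  assumes "u \<in> words S" "w \<in> words S"
  shows "coset (u @ w) = coset u <#>\<^bsub>free_group S\<^esub> coset w"
  using normal.rcos_sum[OF N_normal, of "rho u" "rho w"] assms
  by (simp add: coset_def fmult_def)

lemma coset_relation:
  assumes "(rho u, rho w) \<in> relations"
  shows "coset u = coset w"
proof -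
  have c: "rho u \<in> carrier (free_group S)" "rho w \<in> carrier (free_group S)"
    using assms relations_closed by auto
  have "rho u \<otimes>\<^bsub>free_group S\<^esub> inv\<^bsub>free_group S\<^esub> rho w \<in> relators"
    using assms relators_def by blast
  then have r: "rho u \<otimes>\<^bsub>free_group S\<^esub> inv\<^bsub>free_group S\<^esub> rho w \<in> N"
    by (rule subsetD[OF normal_closure_incl])
  have "N #>\<^bsub>free_group S\<^esub> (rho u \<otimes>\<^bsub>free_group S\<^esub> inv\<^bsub>free_group S\<^esub> rho w) = N"
    by (rule group.coset_join2[OF group_free_group subgroup.mem_carrier[OF N_subgroup r]
          N_subgroup r])
  then show ?thesis
    unfolding coset_def
    by (rule group.coset_mult_inv1[OF group_free_group _ c subgroup.subset[OF N_subgroup]])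
qed

text \<open>The invariant behind completeness of the relations: backtracking along an edge vanishes
  under free reduction, and exchanging the sides of a 2-cell replaces a factor by one with the same
  coset, by \<open>cell_relation\<close>.\<close>

lemma homotopic_coset:
  assumes "homotopic K P Q"
  shows "coset (map label (snd P)) = coset (map label (snd Q))"
  using assms
proof (induction rule: homotopic.induct)
  case (cancel v es a fs)
  have "rho (map label es @ label a # flip (label a) # map label fs)
      = rho (map label es @ map label fs)"
    by (simp add: rho_append rho_Cons push_push_flip)
  then show ?case
    by (simp add: coset_def)
next
  case (cell w cs ds v es fs)
  have walk: "walk K v (es @ cs @ fs)" "walk K v (es @ ds @ fs)"
    using cell by auto
  have "coset (map label cs) = coset (map label ds)"
    using cell_relation[OF cell(1)] by (rule coset_relation)
  then show ?case
    using words_label[OF walk(1)] words_label[OF walk(2)] by (simp add: coset_append)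
qed auto

lemma kernel_eq: "kernel (free_group S) star (free_lift star (edge_class X R)) = N"
proof (intro equalityI subsetI)
  fix w
  assume "w \<in> kernel (free_group S) star (free_lift star (edge_class X R))"
  then have w: "w \<in> carrier (free_group S)" "w \<in> words S"
    and "free_lift star (edge_class X R) w = \<one>\<^bsub>star\<^esub>"
    unfolding kernel_def using free_group_words by blast+
  then have "word_class w = word_class []"
    using free_lift_star[OF w(2)] one_star by simp
  \<comment> \<open>The path of \<open>w\<close> contracts to the constant path. Its labels spell
    \<open>w\<close> again, so the invariant gives \<open>w\<close> the coset of the empty
    word.\<close>
  then have "homotopic K ([], lift [] w) ([], lift [] [])"
    unfolding word_class_def hclass_eq_iff[OF lift_paths[OF w(2)]] .
  from homotopic_coset[OF this] have "N #>\<^bsub>free_group S\<^esub> w = N #>\<^bsub>free_group S\<^esub> []"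
    using w by (simp add: map_label_lift coset_def)
  also have "\<dots> = N"
    using group.coset_mult_one[OF group_free_group subgroup.subset[OF N_subgroup]] by simp
  finally show "w \<in> N"
    using w(1) N_subgroup by (rule group.coset_join1[OF group_free_group])
next
  \<comment> \<open>For the other inclusion it suffices that the kernel, being normal, contains the
    relators.\<close>
  have "x \<in> kernel (free_group S) star (free_lift star (edge_class X R))"
    if x_in: "x \<in> relators" for x
  proof -
    obtain a b where ab: "(a, b) \<in> relations"
      and x: "x = a \<otimes>\<^bsub>free_group S\<^esub> inv\<^bsub>free_group S\<^esub> b"
      using x_in unfolding relators_def by blast
    have c: "a \<in> carrier (free_group S)" "b \<in> carrier (free_group S)"
      using ab relations_closed by auto
    have eq: "free_lift star (edge_class X R) a = free_lift star (edge_class X R) b"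
      using c relation_word_class[OF ab] by (simp add: free_lift_star free_group_words)
    have "free_lift star (edge_class X R) x = free_lift star (edge_class X R) a
        \<otimes>\<^bsub>star\<^esub> inv\<^bsub>star\<^esub> free_lift star (edge_class X R) b"
      using c x FS_star.hom_mult[OF c(1) group.inv_closed[OF group_free_group c(2)]]
      by (simp only: FS_star.hom_inv mult_free_group)
    also have "\<dots> = \<one>\<^bsub>star\<^esub>"
      unfolding eq using c(2) by (intro star.r_inv FS_star.hom_closed)
    finally show ?thesis
      using subsetD[OF relators_closed x_in] by (simp add: kernel_def)
  qed
  then have "relators \<subseteq> kernel (free_group S) star (free_lift star (edge_class X R))"
    by (rule subsetI)
  then have "N \<subseteq> kernel (free_group S) star (free_lift star (edge_class X R))"
    by (rule normal_closure_least[OF FS_star.normal_kernel])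
  then show "w \<in> N \<Longrightarrow> w \<in> kernel (free_group S) star (free_lift star (edge_class X R))" for w
    by (rule subsetD)
qed

lemma defining_relations_star: "defining_relations star S (edge_class X R) relations"
  unfolding defining_relations_def
  using group_star generate_star relations_closed kernel_eq
  by (auto simp: relators_def simp flip: word_class_True)

end

theorem proposition3p6:
  fixes X :: "'x set" and R :: "('x word \<times> 'x word) set"
  assumes "group_presentation X R"
  shows "defining_relations (star1 X R) (S1 X R) (edge_class X R)
    {(gen (lam X l r (v \<cdot> rho s \<cdot> u)) \<cdot> gen (lam X s d u),
      gen (lam X s d u) \<cdot> gen (lam X l r (v \<cdot> rho d \<cdot> u))) | l r s d u v.
      (l, r) \<in> R \<and> (s, d) \<in> R \<and> u \<in> carrier (free_group X) \<and> v \<in> carrier (free_group X)}"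
proof -
  interpret squier_complex X R
    using assms by (rule squier_complex.intro)
  show ?thesis
    using defining_relations_star unfolding relations_def .
qed

end
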